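(* Let $k\geq 2$ be an integer and $f_k(x)=x^{2k+1}+2x+1$. Then for all $a,b\in\mathbb{Z}$ with $a\neq 0$, the polynomial $f_k(ax^2+b)$ is irreducible over $\mathbb{Z}$. *)

theory Defs
  imports "HOL-Computational_Algebra.Polynomial" "Subresultants.Coeff_Int"
begin

(* Irreducibility over the integers is the degree-based notion irreducible\<^sub>d (no factorisation
   in Z[x] into two factors of smaller degree; declared in Missing_Polynomial, which Coeff_Int
   imports).  The ring-theoretic irreducible on int poly also excludes non-unit constant factors,
   and these do occur here: every coefficient of f_k(2x^2 + 1) is even. *)

definition f_poly :: "nat \<Rightarrow> int poly" where
  "f_poly k = monom 1 (2 * k + 1) + smult 2 (monom 1 1) + 1"

end

theory Submission
  imports Defs "Berlekamp_Zassenhaus.Factor_Bound"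
    "HOL-Computational_Algebra.Fundamental_Theorem_Algebra"
begin

text \<open>
  Let \<open>f = f_k\<close>, of degree \<open>2k + 1\<close>. It has one root of modulus at most \<open>1/2\<close> and all its other roots
  lie outside the closed unit disc, so a factor avoiding the small root would have constant term of
  modulus greater than 1; since \<open>f(0) = 1\<close>, \<open>f\<close> is irreducible.

  If \<open>f(a x\<^sup>2 + b) = g h\<close>, then \<open>g(x) g(-x)\<close> is a polynomial in \<open>y = a x\<^sup>2 + b\<close> of the form
  \<open>A(y)\<^sup>2 - (y - b)/a B(y)\<^sup>2\<close>, and it divides \<open>f(y)\<^sup>2\<close>, so it is a constant multiple of \<open>f(y)\<close>. Clearing
  denominators gives \<open>C f = (y - b) Q\<^sup>2 - a P\<^sup>2\<close> over the integers. We may assume that 4 does not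
  divide \<open>a\<close>. Modulo 2 a square has no odd-degree terms, so the odd-degree coefficients of \<open>f\<close>
  determine \<open>Q\<close> modulo 2. If \<open>C\<close> is even, everything can be divided by 4; if \<open>C\<close> is odd, then
  \<open>Q\<close> is \<open>y\<^sup>k\<close> modulo 2, and for \<open>k \<ge> 2\<close> the coefficient \<open>2C\<close> of \<open>y\<close> would be divisible by 4.
\<close>

hide_const (open) up_ring.coeff up_ring.monom Module.smult

section \<open>Irreducibility of f_k from the location of its roots\<close>

lemma coeff_f_poly:
  "coeff (f_poly k) i = (if i = 2 * k + 1 then 1 else 0) + (if i = 1 then 2 else 0) + (if i = 0 then 1 else 0)"
  by (auto simp: f_poly_def coeff_1)

lemma degree_f_poly: "k \<ge> 1 \<Longrightarrow> degree (f_poly k) = 2 * k + 1"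
  by (intro antisym degree_le le_degree) (auto simp: coeff_f_poly)

lemma poly_of_int_f_poly:
  "poly (of_int_poly (f_poly k)) (x :: 'a :: {comm_ring_1, ring_char_0}) = x ^ (2 * k + 1) + 2 * x + 1"
  by (simp add: f_poly_def of_int_poly_hom.hom_add of_int_hom.map_poly_hom_smult poly_monom)

lemma f_poly_real_root:
  obtains \<alpha> :: real where "\<bar>\<alpha>\<bar> \<le> 1 / 2" "\<alpha> ^ (2 * k + 1) + 2 * \<alpha> + 1 = 0"
proof -
  \<comment> \<open>At -1/2 the part 2x + 1 vanishes and only this odd power remains; at 0 the value
    is 1.\<close>
  have "(- 1 / 2 :: real) ^ (2 * k + 1) \<le> 0"
    by (simp add: power_minus_odd)
  then have "\<exists>x\<ge>-1/2. x \<le> 0 \<and> x ^ (2 * k + 1) + 2 * x + 1 = (0::real)"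
    by (intro IVT) (auto intro!: continuous_intros)
  then obtain x where "-1/2 \<le> x" "x \<le> 0" "x ^ (2 * k + 1) + 2 * x + 1 = (0::real)"
    by blast
  then show ?thesis
    by (intro that[of x]) auto
qed

lemma norm_sum_powers_lt_2:
  fixes \<alpha> z :: complex
  assumes "norm \<alpha> \<le> 1 / 2" "norm z \<le> 1"
  shows "norm (\<Sum>i<n. \<alpha> ^ (n - Suc i) * z ^ i) < 2"
proof -
  have "norm (\<Sum>i<n. \<alpha> ^ (n - Suc i) * z ^ i) \<le> (\<Sum>i<n. (1 / 2) ^ (n - Suc i))"
  proof (rule sum_norm_le)
    fix i
    have "norm \<alpha> ^ (n - Suc i) * norm z ^ i \<le> (1 / 2) ^ (n - Suc i) * 1"
      using assms by (intro mult_mono power_mono power_le_one) auto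
    then show "norm (\<alpha> ^ (n - Suc i) * z ^ i) \<le> (1 / 2) ^ (n - Suc i)"
      by (simp add: norm_mult norm_power)
  qed
  also have "\<dots> = (\<Sum>i<n. (1 / 2) ^ i)"
    by (rule sum.nat_diff_reindex)
  also have "\<dots> < (2 :: real)"
    by (simp add: sum_gp_strict)
  finally show ?thesis .
qed

text \<open>For a root \<alpha> the cofactor is (f(z) - f(\<alpha>))/(z - \<alpha>), which is 2 plus
  the power sum bounded above; that sum has norm below 2 on the closed unit disc.\<close>

lemma f_poly_div_root_nonzero:
  fixes \<alpha> z :: complex and p :: "complex poly"
  assumes \<alpha>: "norm \<alpha> \<le> 1 / 2" and p: "of_int_poly (f_poly k) = [:-\<alpha>, 1:] * p" and z: "norm z \<le> 1"
  shows "poly p z \<noteq> 0"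
proof -
  define q where "q = [:2:] + (\<Sum>i<2 * k + 1. monom (\<alpha> ^ (2 * k + 1 - Suc i)) i)"
  have q: "poly q w = 2 + (\<Sum>i<2 * k + 1. \<alpha> ^ (2 * k + 1 - Suc i) * w ^ i)" for w
    by (simp add: q_def poly_sum poly_monom)
  have "poly (of_int_poly (f_poly k)) \<alpha> = 0"
    by (simp add: p)
  then have root: "\<alpha> ^ (2 * k + 1) + 2 * \<alpha> + 1 = 0"
    by (simp only: poly_of_int_f_poly)
  have "[:-\<alpha>, 1:] * p = [:-\<alpha>, 1:] * q"
  proof (rule poly_ext)
    fix w
    have "poly ([:-\<alpha>, 1:] * p) w = w ^ (2 * k + 1) + 2 * w + 1 - (\<alpha> ^ (2 * k + 1) + 2 * \<alpha> + 1)"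
      unfolding root p[symmetric] poly_of_int_f_poly by simp
    also have "\<dots> = (w ^ (2 * k + 1) - \<alpha> ^ (2 * k + 1)) + 2 * (w - \<alpha>)"
      by (simp add: algebra_simps)
    also have "\<dots> = poly ([:-\<alpha>, 1:] * q) w"
      unfolding power_diff_sumr2 poly_mult q by (simp add: algebra_simps)
    finally show "poly ([:-\<alpha>, 1:] * p) w = poly ([:-\<alpha>, 1:] * q) w" .
  qed
  then have "p = q"
    by (simp only: mult_cancel_left) simp
  show ?thesis
  proof
    assume "poly p z = 0"
    then have "norm (\<Sum>i<2 * k + 1. \<alpha> ^ (2 * k + 1 - Suc i) * z ^ i) = norm (-2 :: complex)"
      unfolding \<open>p = q\<close> q by (metis add_eq_0_iff)
    with norm_sum_powers_lt_2[OF \<alpha> z, of "2 * k + 1"] show False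
      by simp
  qed
qed

text \<open>Up to sign, the constant term is the leading coefficient times the product of the
  roots.\<close>

lemma norm_coeff_0_gt_lead_coeff:
  fixes p :: "complex poly"
  assumes "degree p > 0" and "\<And>z. poly p z = 0 \<Longrightarrow> norm z > 1"
  shows "norm (coeff p 0) > norm (lead_coeff p)"
proof -
  obtain r where r: "smult (lead_coeff p) (\<Prod>i<degree p. [:-r i, 1:]) = p"
    by (rule complex_poly_decompose')
  have eval: "poly p z = lead_coeff p * (\<Prod>i<degree p. z - r i)" for z
    by (subst r[symmetric]) (simp add: poly_prod)
  have "norm (r i) > 1" if "i < degree p" for i
    using that by (intro assms(2)) (auto simp: eval)
  then have "1 < (\<Prod>i<degree p. norm (r i))"
    using assms(1) by (intro less_1_prod) auto
  moreover have "norm (coeff p 0) = norm (lead_coeff p) * (\<Prod>i<degree p. norm (r i))"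
    using eval[of 0] by (simp add: poly_0_coeff_0 norm_mult flip: prod_norm)
  moreover have "norm (lead_coeff p) > 0"
    using assms(1) by auto
  ultimately show ?thesis
    by simp
qed

text \<open>With \<alpha> a root of \<open>g\<close>, all roots of \<open>h\<close> lie outside the
  closed unit disc. A nonconstant \<open>h\<close> would then have |h(0)| > 1, against g(0) h(0) =
  1.\<close>

lemma f_poly_factor_with_small_root:
  fixes g h :: "int poly" and \<alpha> :: complex
  assumes k: "k \<ge> 1" and f: "f_poly k = g * h"
    and \<alpha>: "norm \<alpha> \<le> 1 / 2" "poly (of_int_poly g) \<alpha> = 0"
  shows "degree h = 0"
proof (rule ccontr)
  assume deg: "degree h \<noteq> 0"
  obtain g' where g': "of_int_poly g = [:-\<alpha>, 1:] * g'"
    using \<alpha>(2) by (auto simp: poly_eq_0_iff_dvd dvd_def)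
  have f': "of_int_poly (f_poly k) = [:-\<alpha>, 1:] * (g' * of_int_poly h)"
    by (simp only: f of_int_poly_hom.hom_mult g' mult.assoc)
  have "norm z > 1" if "poly (of_int_poly h) z = 0" for z :: complex
    using f_poly_div_root_nonzero[OF \<alpha>(1) f', of z] that by force
  then have "norm (lead_coeff (of_int_poly h :: complex poly)) < norm (coeff (of_int_poly h :: complex poly) 0)"
    using deg by (intro norm_coeff_0_gt_lead_coeff) auto
  moreover have "coeff g 0 * coeff h 0 = 1"
    using coeff_f_poly[of k 0] by (simp add: f coeff_mult_0)
  then have "\<bar>coeff h 0\<bar> = 1"
    by (metis abs_zmult_eq_1 mult.commute abs_1)
  moreover have "\<bar>lead_coeff h\<bar> \<ge> 1"
    using deg by (metis abs_zero degree_0 leading_coeff_0_iff linorder_not_le zabs_less_one_iff)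
  ultimately show False
    by simp
qed

lemma irreducible_f_poly:
  assumes "k \<ge> 1"
  shows "irreducible\<^sub>d (f_poly k)"
proof (rule irreducible\<^sub>dI)
  show "degree (f_poly k) > 0"
    using assms by (simp add: degree_f_poly)
  fix g h :: "int poly"
  assume deg: "degree g > 0" "degree g < degree (f_poly k)" "degree h > 0" "degree h < degree (f_poly k)"
    and f: "f_poly k = g * h"
  obtain \<alpha> :: real where \<alpha>: "\<bar>\<alpha>\<bar> \<le> 1 / 2" "\<alpha> ^ (2 * k + 1) + 2 * \<alpha> + 1 = 0"
    by (rule f_poly_real_root)
  have "poly (of_int_poly (f_poly k)) (complex_of_real \<alpha>) = complex_of_real (\<alpha> ^ (2 * k + 1) + 2 * \<alpha> + 1)"
    unfolding poly_of_int_f_poly by simp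
  then have "poly (of_int_poly g) (complex_of_real \<alpha>) = 0 \<or> poly (of_int_poly h) (complex_of_real \<alpha>) = 0"
    unfolding \<alpha>(2) f by (simp add: of_int_poly_hom.hom_mult)
  then show False
    using f_poly_factor_with_small_root[OF assms f, of "complex_of_real \<alpha>"]
      f_poly_factor_with_small_root[OF assms, of h g "complex_of_real \<alpha>"] f deg \<alpha>(1)
    by (auto simp: mult.commute)
qed

section \<open>Parity of squares and descent on the norm-form equation\<close>

lemma coeff_square_mod_2:
  fixes p :: "int poly"
  shows "even (coeff (p\<^sup>2) (2 * i + 1))" and "even (coeff (p\<^sup>2) (2 * i)) \<longleftrightarrow> even (coeff p i)"
proof -
  have "even (coeff (p\<^sup>2) (2 * i + 1)) \<and> (even (coeff (p\<^sup>2) (2 * i)) \<longleftrightarrow> even (coeff p i))"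
  proof (induction p arbitrary: i)
    case 0
    then show ?case by simp
  next
    case (pCons c p)
    \<comment> \<open>The cross term is even, so p(x)^2 is congruent to p(x^2) modulo 2.\<close>
    have "(pCons c p)\<^sup>2 = [:c\<^sup>2:] + pCons 0 (smult (2 * c) p + pCons 0 (p\<^sup>2))"
      by (rule poly_ext) (simp add: power2_eq_square algebra_simps)
    with pCons.IH[of "i - 1"] show ?case
      by (cases i) (auto simp: coeff_pCons split: nat.splits)
  qed
  then show "even (coeff (p\<^sup>2) (2 * i + 1))" and "even (coeff (p\<^sup>2) (2 * i)) \<longleftrightarrow> even (coeff p i)"
    by auto
qed

lemma all_coeffs_even_obtains_half:
  fixes p :: "int poly"
  assumes "\<And>i. even (coeff p i)"
  obtains q where "p = smult 2 q"
  using assms const_poly_dvd_iff[of 2 p] by (auto simp: dvd_def)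

text \<open>Infinite descent on |C|: halving \<open>P\<close> and \<open>Q\<close> divides
  \<open>C\<close> by 4.\<close>

lemma f_poly_not_norm_form_4_ndvd:
  fixes P Q :: "int poly" and a b C :: int
  assumes k: "k \<ge> 2" and a: "\<not> 4 dvd a" and C: "C \<noteq> 0"
    and eq: "smult C (f_poly k) = [:-b, 1:] * Q\<^sup>2 - smult a (P\<^sup>2)"
  shows False
  using C eq
proof (induction "nat \<bar>C\<bar>" arbitrary: C P Q rule: less_induct)
  case less
  have coeff_Suc: "C * coeff (f_poly k) (Suc i) =
      coeff (Q\<^sup>2) i - b * coeff (Q\<^sup>2) (Suc i) - a * coeff (P\<^sup>2) (Suc i)" for i
    using arg_cong[OF less.prems(2), of "\<lambda>p. coeff p (Suc i)"] by simp
  have coeff_0: "C * coeff (f_poly k) 0 = - b * coeff (Q\<^sup>2) 0 - a * coeff (P\<^sup>2) 0"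
    using arg_cong[OF less.prems(2), of "\<lambda>p. coeff p 0"] by simp
  \<comment> \<open>At index 2i + 1 the terms with \<open>a\<close> and \<open>b\<close> contain
    odd-degree coefficients of squares, which are even.\<close>
  have Q_parity: "even (coeff Q i) \<longleftrightarrow> even (C * coeff (f_poly k) (2 * i + 1))" for i
    using coeff_Suc[of "2 * i"] coeff_square_mod_2[of _ i] by simp
  show False
  proof (cases "even C")
    case True
    then have "even (coeff Q i)" for i
      using Q_parity by simp
    then obtain Q' where Q': "Q = smult 2 Q'"
      using all_coeffs_even_obtains_half by blast
    have CaP_mod_4: "4 dvd C * coeff (f_poly k) i + a * coeff (P\<^sup>2) i" for i
      using coeff_Suc[of "i - 1"] coeff_0
      by (cases i) (auto simp: Q' power2_eq_square)
    have lead: "coeff (f_poly k) (2 * k + 1) = 1"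
      using k by (simp add: coeff_f_poly)
    have "even (coeff P i)" for i
    proof (cases "even a")
      case True
      then obtain a' where a': "a = 2 * a'" "odd a'"
        using a by (auto simp: dvd_def)
      \<comment> \<open>The odd degree 2k + 1 comes first: there a P^2 contributes a multiple of 4,
        so 4 divides \<open>C\<close>. At even degrees what remains is 2 a' P^2 modulo 4 with a'
        odd, which fixes the parity of \<open>P\<close>.\<close>
      obtain e where "coeff (P\<^sup>2) (2 * k + 1) = 2 * e"
        using coeff_square_mod_2(1)[of P k] by (auto simp: dvd_def)
      then have "4 dvd C + 4 * (a' * e)"
        using CaP_mod_4[of "2 * k + 1"] unfolding lead by (simp add: a' mult.left_commute)
      then have "4 dvd C"
        by presburger
      then have "4 dvd a * coeff (P\<^sup>2) (2 * i)"
        using CaP_mod_4[of "2 * i"] by (meson dvd_add_right_iff dvd_mult2)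
      then have "4 dvd 2 * (a' * coeff (P\<^sup>2) (2 * i))"
        by (simp only: a' mult.assoc)
      then have "even (a' * coeff (P\<^sup>2) (2 * i))"
        by (metis dvd_times_left_cancel_iff mult_2 numeral_Bit0 zero_neq_numeral)
      then show ?thesis
        using a'(2) coeff_square_mod_2(2)[of P i] by simp
    next
      case False
      have "even (C * coeff (f_poly k) (2 * i) + a * coeff (P\<^sup>2) (2 * i))"
        by (rule dvd_trans[OF _ CaP_mod_4]) simp
      then show ?thesis
        using \<open>even C\<close> False coeff_square_mod_2(2)[of P i] by simp
    qed
    then obtain P' where P': "P = smult 2 P'"
      using all_coeffs_even_obtains_half by blast
    \<comment> \<open>The leading coefficient, now with \<open>P\<close> even, gives 4 | C for
      either parity of \<open>a\<close>.\<close>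
    have "4 dvd C + 4 * (a * coeff (P'\<^sup>2) (2 * k + 1))"
      using CaP_mod_4[of "2 * k + 1"] unfolding lead by (simp add: P' power2_eq_square mult.left_commute)
    then have "4 dvd C"
      by presburger
    then obtain C' where C': "C = 4 * C'"
      by (rule dvdE)
    have "smult 4 (smult C' (f_poly k)) = smult 4 ([:-b, 1:] * Q'\<^sup>2 - smult a (P'\<^sup>2))"
      using less.prems(2) by (simp add: C' Q' P' power2_eq_square smult_diff_right algebra_simps smult_add_right)
    then have "smult C' (f_poly k) = [:-b, 1:] * Q'\<^sup>2 - smult a (P'\<^sup>2)"
      by (rule smult_cancel[rotated]) simp
    moreover have "nat \<bar>C'\<bar> < nat \<bar>C\<bar>" "C' \<noteq> 0"
      using less.prems(1) C' by auto
    ultimately show False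
      using less.hyps by blast
  next
    case False
    \<comment> \<open>The coefficients of y and y^3 in f_k are 2 and 0; the latter needs k \<ge> 2,
      so that 2k + 1 > 3.\<close>
    have Q01: "even (coeff Q 0)" "even (coeff Q 1)"
      using k by (simp_all add: Q_parity coeff_f_poly)
    have "odd a"
      using coeff_0 Q01(1) False by (auto simp: coeff_f_poly power2_eq_square coeff_mult_0)
    \<comment> \<open>Comparing coefficients of y^2, which is absent from f_k, makes the
      y-coefficient of \<open>P\<close> even.\<close>
    have "a * coeff (P\<^sup>2) 2 = coeff (Q\<^sup>2) 1 - b * coeff (Q\<^sup>2) 2"
      using coeff_Suc[of 1] k by (simp add: coeff_f_poly flip: numeral_2_eq_2)
    moreover have "even (coeff (Q\<^sup>2) 1 - b * coeff (Q\<^sup>2) 2)"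
      using coeff_square_mod_2(1)[of Q 0] coeff_square_mod_2(2)[of Q 1] Q01(2) by simp
    ultimately have "even (coeff (P\<^sup>2) 2)"
      using \<open>odd a\<close> by (metis even_mult_iff)
    then have "even (coeff P 1)"
      using coeff_square_mod_2(2)[of P 1] by simp
    \<comment> \<open>In the coefficient of y every term on the right is now divisible by 4, so
      \<open>C\<close> would be even.\<close>
    have "2 * C = (coeff Q 0)\<^sup>2 - 2 * b * (coeff Q 0 * coeff Q 1) - 2 * a * (coeff P 0 * coeff P 1)"
      using coeff_Suc[of 0] k by (simp add: coeff_f_poly power2_eq_square coeff_mult algebra_simps)
    moreover obtain q0 q1 p1 where qp: "coeff Q 0 = 2 * q0" "coeff Q 1 = 2 * q1" "coeff P 1 = 2 * p1"
      using Q01 \<open>even (coeff P 1)\<close> unfolding dvd_def by blast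
    ultimately have "C = 2 * (q0\<^sup>2 - 2 * (b * q0 * q1) - a * coeff P 0 * p1)"
      unfolding qp by (simp add: power2_eq_square algebra_simps)
    with False show False
      by simp
  qed
qed

text \<open>A factor 4 of \<open>a\<close> is absorbed into the square by passing from
  \<open>P\<close> to \<open>2 P\<close>, which lowers |a|.\<close>

lemma f_poly_not_norm_form:
  fixes P Q :: "int poly" and a b C :: int
  assumes "k \<ge> 2" and "a \<noteq> 0" and "C \<noteq> 0"
    and "smult C (f_poly k) = [:-b, 1:] * Q\<^sup>2 - smult a (P\<^sup>2)"
  shows False
  using assms(2,4)
proof (induction "nat \<bar>a\<bar>" arbitrary: a P rule: less_induct)
  case less
  show ?case
  proof (cases "4 dvd a")
    case True
    then obtain a' where a': "a = 4 * a'"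
      by (auto simp: dvd_def)
    then have "smult a (P\<^sup>2) = smult a' ((smult 2 P)\<^sup>2)"
      by (simp add: power2_eq_square mult.commute)
    moreover have "nat \<bar>a'\<bar> < nat \<bar>a\<bar>" "a' \<noteq> 0"
      using less.prems(1) a' by auto
    ultimately show ?thesis
      using less.hyps less.prems(2) by metis
  next
    case False
    with f_poly_not_norm_form_4_ndvd assms(1,3) less.prems show ?thesis
      by blast
  qed
qed

section \<open>Norms from K[x] to K[y], where y = a x^2 + b\<close>

lemma poly_split_quadratic:
  fixes g :: "'a :: field poly"
  assumes "a \<noteq> 0"
  obtains A B where "g = pcompose A [:b, 0, a:] + [:0, 1:] * pcompose B [:b, 0, a:]"
proof -
  have "\<exists>A B. g = pcompose A [:b, 0, a:] + [:0, 1:] * pcompose B [:b, 0, a:]"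
  proof (induction g)
    case 0
    show ?case by (intro exI[of _ 0]) simp
  next
    case (pCons c p)
    then obtain A B where p: "p = pcompose A [:b, 0, a:] + [:0, 1:] * pcompose B [:b, 0, a:]"
      by blast
    \<comment> \<open>Since x^2 = (y - b)/a, c + x (A + x B) equals (c + (y - b)/a B) + x A.\<close>
    have x2: "pcompose [:-b/a, 1/a:] [:b, 0, a:] = [:0, 0, 1:]"
      using assms by (simp add: pcompose_pCons)
    have "pCons c p = pcompose ([:c:] + [:-b/a, 1/a:] * B) [:b, 0, a:] + [:0, 1:] * pcompose A [:b, 0, a:]"
      unfolding pcompose_add pcompose_mult x2 by (simp add: p pcompose_pCons)
    then show ?case
      by blast
  qed
  with that show ?thesis
    by blast
qed

text \<open>The conjugation x -> -x fixes y, so g = A + x B has norm (A + x B)(A - x B) = A^2 - x^2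
  B^2. Composition with y doubles degrees, and g(x) g(-x) has degree 2 deg g.\<close>

lemma poly_norm_quadratic:
  fixes g :: "'a :: field poly"
  assumes a: "a \<noteq> 0"
  obtains A B where
    "g * pcompose g [:0, -1:] = pcompose (A\<^sup>2 - [:-b/a, 1/a:] * B\<^sup>2) [:b, 0, a:]"
    "degree (A\<^sup>2 - [:-b/a, 1/a:] * B\<^sup>2) = degree g"
proof -
  let ?S = "[:b, 0, a:]"
  obtain A B where g: "g = pcompose A ?S + [:0, 1:] * pcompose B ?S"
    using poly_split_quadratic[OF a] by blast
  have S: "pcompose (pcompose p ?S) [:0, -1:] = pcompose p ?S" for p
    by (simp add: pcompose_assoc[symmetric] pcompose_pCons)
  have x2: "pcompose [:-b/a, 1/a:] ?S = [:0, 1:] * [:0, 1:]"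
    using a by (simp add: pcompose_pCons)
  have "pcompose g [:0, -1:] = pcompose A ?S - [:0, 1:] * pcompose B ?S"
    by (simp add: g pcompose_add pcompose_mult S pcompose_pCons)
  then have "g * pcompose g [:0, -1:] =
      (pcompose A ?S)\<^sup>2 - [:0, 1:] * [:0, 1:] * (pcompose B ?S)\<^sup>2"
    by (subst g) (simp only: power2_eq_square ring_distribs mult_ac, simp)
  also have "\<dots> = pcompose (A\<^sup>2 - [:-b/a, 1/a:] * B\<^sup>2) ?S"
    by (simp only: x2 pcompose_diff pcompose_mult power2_eq_square)
  finally have *: "g * pcompose g [:0, -1:] = pcompose (A\<^sup>2 - [:-b/a, 1/a:] * B\<^sup>2) ?S" .
  have "degree (g * pcompose g [:0, -1:]) = 2 * degree g"
    by (cases "g = 0") (simp_all add: degree_mult_eq pcompose_eq_0_iff degree_pcompose)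
  then have "degree (A\<^sup>2 - [:-b/a, 1/a:] * B\<^sup>2) = degree g"
    unfolding * degree_pcompose using a by simp
  with * that show ?thesis
    by blast
qed

text \<open>The prime \<open>p\<close> divides \<open>M\<close> or \<open>M'\<close>. Cancelling one
  \<open>p\<close> leaves a factorisation of \<open>p\<close> with a nonconstant factor, so the
  other factor is constant.\<close>

lemma irreducible_square_factor:
  fixes p M M' :: "'a :: field_gcd poly"
  assumes p: "irreducible\<^sub>d p" and eq: "p\<^sup>2 = M * M'" and deg: "degree M > 0" "degree M' > 0"
  obtains c where "c \<noteq> 0" "M = smult c p"
proof -
  have irr: "irreducible p"
    using p by simp
  then have "prime_elem p"
    by (simp add: irreducible_imp_prime_elem_gcd)
  have p0: "p \<noteq> 0"
    using irr by auto
  have const: "degree u = 0 \<or> degree v = 0" if "p = u * v" for u v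
    using irreducibleD[OF irr that] by (auto simp: is_unit_iff_degree)
  have "p dvd M * M'"
    by (simp flip: eq add: power2_eq_square)
  then consider "p dvd M" | "p dvd M'"
    using prime_elem_dvd_multD[OF \<open>prime_elem p\<close>] by blast
  then show ?thesis
  proof cases
    case 1
    then obtain W where W: "M = p * W" by (rule dvdE)
    with eq p0 have "p = W * M'"
      by (simp add: power2_eq_square mult.assoc)
    with const deg have "degree W = 0" by fastforce
    then obtain c where "W = [:c:]"
      by (rule degree_eq_zeroE)
    with W deg show ?thesis
      by (intro that[of c]) auto
  next
    case 2
    then obtain W where W: "M' = p * W" by (rule dvdE)
    with eq p0 have pW: "p = M * W"
      by (simp add: power2_eq_square mult.left_commute)
    with const deg have "degree W = 0" by fastforce
    then obtain c where c: "W = [:c:]"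
      by (rule degree_eq_zeroE)
    with pW p0 show ?thesis
      by (intro that[of "inverse c"]) auto
  qed
qed

section \<open>Clearing denominators in the norm form\<close>

lemma rat_poly_common_denominator:
  fixes A :: "rat poly"
  obtains d :: int and P :: "int poly" where "d \<noteq> 0" "smult (of_int d) A = of_int_poly P"
proof -
  obtain d P where "rat_to_int_poly A = (d, P)"
    by fastforce
  from rat_to_int_poly[OF this] show ?thesis
    by (intro that[of d P]) auto
qed

lemma rat_norm_form_imp_int_norm_form:
  fixes f :: "int poly" and A B :: "rat poly" and a b :: int
  assumes a: "a \<noteq> 0" and c: "c \<noteq> 0"
    and eq: "A\<^sup>2 - [:- of_int b / of_int a, 1 / of_int a:] * B\<^sup>2 = smult c (of_int_poly f)"
  obtains C P Q where "C \<noteq> 0" "smult C f = [:-b, 1:] * Q\<^sup>2 - smult a (P\<^sup>2)"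
proof -
  obtain d P where d: "d \<noteq> 0" "smult (of_int d) A = of_int_poly P"
    by (rule rat_poly_common_denominator)
  obtain e Q where e: "e \<noteq> 0" "smult (of_int e) B = of_int_poly Q"
    by (rule rat_poly_common_denominator)
  obtain m n where mn: "c = of_int m / of_int n" "n \<noteq> 0"
    by (metis Fract_of_int_quotient Rat_cases less_irrefl)
  let ?r = "of_int :: int \<Rightarrow> rat"
  \<comment> \<open>The identity is multiplied by -a (n d e)^2. The factor n^2, rather than n, lets
    the scaling be absorbed into the squares of A and B.\<close>
  define C where "C = - a * m * n * (d * e)\<^sup>2"
  have r: "?r C = - ?r a * c * (?r (n * d * e))\<^sup>2"
    using mn by (simp add: C_def power2_eq_square)
  have A: "of_int_poly (smult (n * e) P) = smult (?r (n * d * e)) A"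
    by (simp add: of_int_hom.map_poly_hom_smult mult_ac flip: d(2))
  have B: "of_int_poly (smult (n * d) Q) = smult (?r (n * d * e)) B"
    by (simp add: of_int_hom.map_poly_hom_smult mult_ac flip: e(2))
  have "smult (?r a) (smult c (of_int_poly f)) = smult (?r a) (A\<^sup>2) - [:- ?r b, 1:] * B\<^sup>2"
    using a by (simp flip: eq add: smult_diff_right)
  then have "[:- ?r b, 1:] * (smult (?r (n * d * e)) B)\<^sup>2 - smult (?r a) ((smult (?r (n * d * e)) A)\<^sup>2) =
      smult ((?r (n * d * e))\<^sup>2) (- smult (?r a) (smult c (of_int_poly f)))"
    by (simp add: power2_eq_square smult_diff_right mult_ac)
  also have "\<dots> = smult (?r C) (of_int_poly f)"
    by (simp add: r mult_ac)
  finally have "(of_int_poly (smult C f) :: rat poly) =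
      of_int_poly ([:-b, 1:] * (smult (n * d) Q)\<^sup>2 - smult a ((smult (n * e) P)\<^sup>2))"
    by (simp only: of_int_poly_hom.hom_minus of_int_poly_hom.hom_mult of_int_poly_hom.hom_power
        of_int_hom.map_poly_hom_smult A[unfolded of_int_hom.map_poly_hom_smult]
        B[unfolded of_int_hom.map_poly_hom_smult]) simp
  then have "smult C f = [:-b, 1:] * (smult (n * d) Q)\<^sup>2 - smult a ((smult (n * e) P)\<^sup>2)"
    by (simp only: of_int_poly_hom.eq_iff)
  moreover have "C \<noteq> 0"
    using a c mn d e by (auto simp: C_def)
  ultimately show ?thesis
    using that by blast
qed

section \<open>Irreducibility of the composed polynomial\<close>

theorem theorem1p5:
  fixes k :: nat and a b :: int
  assumes "k \<ge> 2" and "a \<noteq> 0"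
  shows "irreducible\<^sub>d (pcompose (f_poly k) (smult a (monom 1 2) + [:b:]))"
proof (rule irreducible\<^sub>dI)
  let ?r = "of_int :: int \<Rightarrow> rat" and ?R = "of_int_poly :: int poly \<Rightarrow> rat poly"
  let ?S = "[:?r b, 0, ?r a:]"
  have S: "smult a (monom 1 2) + [:b:] = [:b, 0, a:]"
    by (simp add: monom_altdef power2_eq_square)
  show "degree (pcompose (f_poly k) (smult a (monom 1 2) + [:b:])) > 0"
    unfolding S degree_pcompose using assms by (simp add: degree_f_poly)
  fix g h :: "int poly"
  assume deg: "degree g > 0" "degree h > 0"
    and gh: "pcompose (f_poly k) (smult a (monom 1 2) + [:b:]) = g * h"
  have a: "?r a \<noteq> 0"
    using assms by simp
  obtain A B where AB: "?R g * pcompose (?R g) [:0, -1:] =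
      pcompose (A\<^sup>2 - [:-?r b/?r a, 1/?r a:] * B\<^sup>2) ?S"
    "degree (A\<^sup>2 - [:-?r b/?r a, 1/?r a:] * B\<^sup>2) = degree (?R g)"
    using poly_norm_quadratic[OF a] by blast
  obtain A' B' where AB': "?R h * pcompose (?R h) [:0, -1:] =
      pcompose (A'\<^sup>2 - [:-?r b/?r a, 1/?r a:] * B'\<^sup>2) ?S"
    "degree (A'\<^sup>2 - [:-?r b/?r a, 1/?r a:] * B'\<^sup>2) = degree (?R h)"
    using poly_norm_quadratic[OF a] by blast
  have gh': "pcompose (?R (f_poly k)) ?S = ?R g * ?R h"
    using arg_cong[OF gh, of ?R] unfolding S
    by (simp add: of_int_poly_hom.hom_mult of_int_hom.map_poly_pcompose of_int_hom.map_poly_pCons_hom)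
  \<comment> \<open>Replacing x by -x yields a second factorisation of f(y); the product of both
    expresses f(y)^2 through the norms of \<open>g\<close> and \<open>h\<close>.\<close>
  have "pcompose ?S [:0, -1:] = ?S"
    by (simp add: pcompose_pCons)
  then have "pcompose (?R (f_poly k)) ?S = pcompose (?R g) [:0, -1:] * pcompose (?R h) [:0, -1:]"
    by (metis gh' pcompose_assoc pcompose_mult)
  then have "pcompose ((?R (f_poly k))\<^sup>2) ?S =
      (?R g * pcompose (?R g) [:0, -1:]) * (?R h * pcompose (?R h) [:0, -1:])"
    using gh' by (simp add: power2_eq_square pcompose_mult mult_ac)
  \<comment> \<open>Composition with the nonconstant \<open>?S\<close> is injective, so the identity
    descends to polynomials in y.\<close>
  then have "pcompose ((?R (f_poly k))\<^sup>2 - (A\<^sup>2 - [:-?r b/?r a, 1/?r a:] * B\<^sup>2) *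
      (A'\<^sup>2 - [:-?r b/?r a, 1/?r a:] * B'\<^sup>2)) ?S = 0"
    unfolding AB AB' by (simp only: pcompose_diff pcompose_mult diff_self)
  then have "(?R (f_poly k))\<^sup>2 = (A\<^sup>2 - [:-?r b/?r a, 1/?r a:] * B\<^sup>2) *
      (A'\<^sup>2 - [:-?r b/?r a, 1/?r a:] * B'\<^sup>2)"
    using a by (subst (asm) pcompose_eq_0_iff) auto
  moreover have "irreducible\<^sub>d (?R (f_poly k))"
    using assms by (intro irreducible\<^sub>d_int_rat irreducible_f_poly) simp
  \<comment> \<open>The norms have the degrees of \<open>g\<close> and \<open>h\<close>, so neither
    is constant.\<close>
  ultimately obtain c where "c \<noteq> 0" "A\<^sup>2 - [:-?r b/?r a, 1/?r a:] * B\<^sup>2 = smult c (?R (f_poly k))"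
    using deg AB(2) AB'(2) irreducible_square_factor by (metis of_int_hom.degree_map_poly_hom)
  then show False
    using rat_norm_form_imp_int_norm_form[OF assms(2)] f_poly_not_norm_form[OF assms] by metis
qed

end
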